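(* Let $M(0)=0$ and, for $n\ge 1$, let $M(n)=\max_{i\ge 0}\sum_{j=i}^{i+n-1}r(j)$ be the maximal sum of $n$ consecutive terms of the Rudin-Shapiro sequence $\mathbf{r}=(r(n))_{n\ge0}$, and let $\Delta M(n)=M(n+1)-M(n)$ for $n\ge 0$. Then $\Delta M(i)=1$ for $0\le i\le 3$, and for all $n\ge 1$, $$\Delta M(4n)=-\Delta M(4n+3)=-1,\qquad \Delta M(4n+1)=\Delta M(4n+2)=\Delta M(n).$$ Moreover, $(\Delta M(n))_{n\ge 0}$ is a $2$-automatic sequence.
   Context: The Rudin-Shapiro sequence $\mathbf{r}\in\{-1,1\}^{\mathbb{N}}$ is defined by $r(0)=1$, $r(2n)=r(n)$, $r(2n+1)=(-1)^n r(n)$ for $n\ge 0$. A sequence $(w(n))_{n\ge 0}$ is $2$-automatic if its $2$-kernel $\{(w(2^e n+c))_{n\ge 0} : e\ge 0,\ 0\le c<2^e\}$ is a finite set of sequences. *)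

theory Defs
  imports Main
begin

function rudin_shapiro :: "nat \<Rightarrow> int" where
  "rudin_shapiro n =
     (if n = 0 then 1
      else if even n then rudin_shapiro (n div 2)
      else (-1) ^ (n div 2) * rudin_shapiro (n div 2))"
  by pat_completeness auto
termination
  by (relation "measure id") (auto elim: oddE)

declare rudin_shapiro.simps [simp del]

lemma rudin_shapiro_0: "rudin_shapiro 0 = 1"
  by (simp add: rudin_shapiro.simps)

lemma rudin_shapiro_even: "rudin_shapiro (2 * n) = rudin_shapiro n"
  by (cases "n = 0") (simp_all add: rudin_shapiro.simps [of "2 * n"])

lemma rudin_shapiro_odd: "rudin_shapiro (2 * n + 1) = (-1) ^ n * rudin_shapiro n"
  by (subst rudin_shapiro.simps) simp

lemma abs_rudin_shapiro: "\<bar>rudin_shapiro n\<bar> = 1"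
proof (induction n rule: less_induct)
  case (less n)
  show ?case
  proof (cases "n = 0")
    case True
    then show ?thesis by (simp add: rudin_shapiro_0)
  next
    case False
    then have "\<bar>rudin_shapiro (n div 2)\<bar> = 1"
      by (intro less.IH) simp
    with False show ?thesis
      by (simp add: rudin_shapiro.simps [of n] abs_mult power_abs)
  qed
qed

definition rs_max_sum :: "nat \<Rightarrow> int" where
  "rs_max_sum n =
     (if n = 0 then 0 else Max (range (\<lambda>i. \<Sum>j = i..<i + n. rudin_shapiro j)))"

text \<open>The set of window sums is finite, so \<open>Max\<close> above is a genuine maximum.\<close>

lemma finite_rs_window_sums:
  "finite (range (\<lambda>i. \<Sum>j = i..<i + n. rudin_shapiro j))"
proof (rule finite_subset)
  have "\<bar>\<Sum>j = i..<i + n. rudin_shapiro j\<bar> \<le> int n" for i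
    using sum_abs [of rudin_shapiro "{i..<i + n}"] by (simp add: abs_rudin_shapiro)
  then show "range (\<lambda>i. \<Sum>j = i..<i + n. rudin_shapiro j) \<subseteq> {- int n..int n}"
    by (auto simp: abs_le_iff minus_le_iff)
qed simp

definition delta_rs_max_sum :: "nat \<Rightarrow> int" where
  "delta_rs_max_sum n = rs_max_sum (n + 1) - rs_max_sum n"

definition two_kernel :: "(nat \<Rightarrow> 'a) \<Rightarrow> (nat \<Rightarrow> 'a) set" where
  "two_kernel w = {(\<lambda>n. w (2 ^ e * n + c)) | e c. c < 2 ^ e}"

definition two_automatic :: "(nat \<Rightarrow> 'a) \<Rightarrow> bool" where
  "two_automatic w \<longleftrightarrow> finite (two_kernel w)"

end

theory Submission
  imports Defs
begin

text \<open>
  Write \<open>r\<close> for the Rudin-Shapiro sequence, \<open>t n = r (2 * n + 1)\<close>, and \<open>M\<close> for the maximal window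
  sum. The four terms of \<open>r\<close> from index \<open>4 * n\<close> on are \<open>r n, r n, t n, - t n\<close>, so a window with
  endpoints \<open>4 * a + c\<close> and \<open>4 * b + d\<close> has twice the sum of the window from \<open>a\<close> to \<open>b\<close>, up to a
  correction that depends only on \<open>r\<close> and \<open>t\<close> at \<open>a\<close> and \<open>b\<close>. Since these are \<open>\<plusminus>1\<close>, going through
  the four start residues bounds \<open>M (4 * n + k)\<close> as follows (\<open>rs_max_sum_upper\<close>):
  \[ M(4n) \le 2M(n)+2,\quad M(4n+1) \le 2M(n)+1, \]
  \[ M(4n+2) \le M(n)+M(n+1)+1,\quad M(4n+3) \le 2M(n+1)+1. \]

  If all four are equalities, then taking differences gives the recursion for the increments.
  Equality needs windows that have maximal sum and in addition suitable signs at their ends,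
  and it is enough to carry two kinds of sign conditions through an induction on base 4 digits.
  A window is \<^emph>\<open>framed\<close> if it is maximal, \<open>t\<close> is \<open>-1\<close> just before it and \<open>t\<close> is \<open>1\<close>
  at its last position; such a window of length \<open>n\<close> yields equality for \<open>4 * n\<close>.
  Equality for \<open>4 * n + 1\<close>, \<open>4 * n + 2\<close> and \<open>4 * n + 3\<close> comes from a pair of
  nested maximal windows of lengths \<open>n\<close> and \<open>n + 1\<close>: they share the left end if the maximum grows
  (\<open>grows_right\<close>), and the right end if it drops (\<open>drops_left\<close>). The windows of length
  \<open>4 * n + k\<close> built from these witnesses are again witnesses of the same kinds
  (\<open>framed_and_nested_maximal_windows\<close>), and this closes the induction.

  Finally, the recursion shows that a set of six sequences contains the sequence of increments
  and is stable under \<open>f \<mapsto> (\<lambda>n. f (2 * n))\<close> and \<open>f \<mapsto> (\<lambda>n. f (2 * n + 1))\<close>, so it contains the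
  2-kernel.
\<close>

section \<open>Prefix sums along base 4 digits\<close>

definition rs_odd :: "nat \<Rightarrow> int" where
  "rs_odd n = rudin_shapiro (2 * n + 1)"

definition rs_prefix :: "nat \<Rightarrow> int" where
  "rs_prefix n = (\<Sum>j<n. rudin_shapiro j)"

lemma base4_digit_cases:
  fixes i :: nat
  obtains a where "i = 4 * a \<or> i = 4 * a + 1 \<or> i = 4 * a + 2 \<or> i = 4 * a + 3"
proof -
  have "\<exists>a. i = 4 * a \<or> i = 4 * a + 1 \<or> i = 4 * a + 2 \<or> i = 4 * a + 3"
    by presburger
  with that show thesis by blast
qed

lemma rs_odd_even_index: "rs_odd (2 * n) = rudin_shapiro n"
  using rudin_shapiro_odd [of "2 * n"] by (simp add: rs_odd_def rudin_shapiro_even)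

lemma rs_odd_odd_index: "rs_odd (2 * n + 1) = - rs_odd n"
  using rudin_shapiro_odd [of "2 * n + 1"] by (simp add: rs_odd_def)

lemma rudin_shapiro_base4:
  "rudin_shapiro (4 * n) = rudin_shapiro n"
  "rudin_shapiro (4 * n + 1) = rudin_shapiro n"
  "rudin_shapiro (4 * n + 2) = rs_odd n"
  "rudin_shapiro (4 * n + 3) = - rs_odd n"
proof -
  have index: "2 * (2 * n + 1) + 1 = 4 * n + 3" by simp
  show "rudin_shapiro (4 * n) = rudin_shapiro n"
    using rudin_shapiro_even [of "2 * n"] by (simp add: rudin_shapiro_even)
  show "rudin_shapiro (4 * n + 1) = rudin_shapiro n"
    using rs_odd_even_index [of n] by (simp add: rs_odd_def)
  show "rudin_shapiro (4 * n + 2) = rs_odd n"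
    using rudin_shapiro_even [of "2 * n + 1"] by (simp add: rs_odd_def)
  show "rudin_shapiro (4 * n + 3) = - rs_odd n"
    using rs_odd_odd_index [of n] by (simp only: rs_odd_def [of "2 * n + 1"] index)
qed

lemma rs_odd_base4:
  "rs_odd (4 * n) = rudin_shapiro n"
  "rs_odd (4 * n + 2) = rs_odd n"
  "rs_odd (4 * n + 3) = rs_odd n"
proof -
  have index: "2 * (2 * n + 1) + 1 = 4 * n + 3" by simp
  show "rs_odd (4 * n) = rudin_shapiro n"
    using rs_odd_even_index [of "2 * n"] by (simp add: rudin_shapiro_even)
  show "rs_odd (4 * n + 2) = rs_odd n"
    using rs_odd_even_index [of "2 * n + 1"] by (simp add: rs_odd_def)
  show "rs_odd (4 * n + 3) = rs_odd n"
    using rs_odd_odd_index [of "2 * n + 1"] rs_odd_odd_index [of n] by (simp only: index minus_minus)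
qed

lemma rs_bounds:
  "rudin_shapiro n \<le> 1" "- 1 \<le> rudin_shapiro n" "rs_odd n \<le> 1" "- 1 \<le> rs_odd n"
  using abs_rudin_shapiro [of n] abs_rudin_shapiro [of "2 * n + 1"]
  unfolding rs_odd_def by linarith+

lemma rs_prefix_add_1: "rs_prefix (n + 1) = rs_prefix n + rudin_shapiro n"
  by (simp add: rs_prefix_def)

lemma rs_prefix_base4:
  "rs_prefix (4 * n) = 2 * rs_prefix n"
  "rs_prefix (4 * n + 1) = 2 * rs_prefix n + rudin_shapiro n"
  "rs_prefix (4 * n + 2) = 2 * rs_prefix n + 2 * rudin_shapiro n"
  "rs_prefix (4 * n + 3) = 2 * rs_prefix n + 2 * rudin_shapiro n + rs_odd n"
proof -
  have step:
    "rs_prefix (4 * m + 1) = rs_prefix (4 * m) + rudin_shapiro m"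
    "rs_prefix (4 * m + 2) = rs_prefix (4 * m) + 2 * rudin_shapiro m"
    "rs_prefix (4 * m + 3) = rs_prefix (4 * m) + 2 * rudin_shapiro m + rs_odd m"
    "rs_prefix (4 * m + 4) = rs_prefix (4 * m) + 2 * rudin_shapiro m" for m
    using rs_prefix_add_1 [of "4 * m"] rs_prefix_add_1 [of "4 * m + 1"]
      rs_prefix_add_1 [of "4 * m + 2"] rs_prefix_add_1 [of "4 * m + 3"]
      rudin_shapiro_base4 [of m]
    by (simp_all add: eval_nat_numeral)
  show main: "rs_prefix (4 * n) = 2 * rs_prefix n"
  proof (induction n)
    case 0
    show ?case by (simp add: rs_prefix_def)
  next
    case (Suc n)
    then show ?case
      using step(4) [of n] rs_prefix_add_1 [of n] by (simp add: add.commute)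
  qed
  show "rs_prefix (4 * n + 1) = 2 * rs_prefix n + rudin_shapiro n"
    "rs_prefix (4 * n + 2) = 2 * rs_prefix n + 2 * rudin_shapiro n"
    "rs_prefix (4 * n + 3) = 2 * rs_prefix n + 2 * rudin_shapiro n + rs_odd n"
    using step [of n] main by simp_all
qed

section \<open>Maximal window sums and their upper bounds\<close>

lemma sum_window_eq_rs_prefix:
  "(\<Sum>j = i..<i + n. rudin_shapiro j) = rs_prefix (i + n) - rs_prefix i"
  by (induction n) (simp_all add: rs_prefix_def)

lemma window_le_rs_max_sum: "rs_prefix (i + n) - rs_prefix i \<le> rs_max_sum n"
proof (cases "n = 0")
  case True
  then show ?thesis by (simp add: rs_max_sum_def)
next
  case False
  have "(\<Sum>j = i..<i + n. rudin_shapiro j) \<le> Max (range (\<lambda>i. \<Sum>j = i..<i + n. rudin_shapiro j))"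
    by (rule Max_ge [OF finite_rs_window_sums]) simp
  with False show ?thesis
    by (simp add: rs_max_sum_def sum_window_eq_rs_prefix)
qed

lemma rs_max_sum_le:
  assumes "\<And>i. rs_prefix (i + n) - rs_prefix i \<le> v"
  shows "rs_max_sum n \<le> v"
proof (cases "n = 0")
  case True
  then show ?thesis using assms [of 0] by (simp add: rs_max_sum_def)
next
  case False
  have "Max (range (\<lambda>i. \<Sum>j = i..<i + n. rudin_shapiro j)) \<le> v"
    using assms by (subst Max_le_iff [OF finite_rs_window_sums]) (auto simp: sum_window_eq_rs_prefix)
  with False show ?thesis by (simp add: rs_max_sum_def)
qed

text \<open>
  A window of length \<open>4 * n + k\<close> that starts at \<open>4 * a + c\<close> is compared with the windows of length
  \<open>n\<close> and \<open>n + 1\<close> that start at \<open>a\<close> or \<open>a + 1\<close>. In each of the sixteen cases, its sum is the sum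
  of two of these four windows plus at most one boundary sign, or two boundary signs if \<open>k = 0\<close>.
\<close>

lemma rs_max_sum_upper:
  "rs_max_sum (4 * n) \<le> 2 * rs_max_sum n + 2"
  "rs_max_sum (4 * n + 1) \<le> 2 * rs_max_sum n + 1"
  "rs_max_sum (4 * n + 2) \<le> rs_max_sum n + rs_max_sum (n + 1) + 1"
  "rs_max_sum (4 * n + 3) \<le> 2 * rs_max_sum (n + 1) + 1"
proof -
  have coarse:
    "rs_prefix (a + n) - rs_prefix a \<le> rs_max_sum n"
    "rs_prefix (a + n) + rudin_shapiro (a + n) - rs_prefix a - rudin_shapiro a \<le> rs_max_sum n"
    "rs_prefix (a + n) + rudin_shapiro (a + n) - rs_prefix a \<le> rs_max_sum (n + 1)"
    "rs_prefix (a + n) + rudin_shapiro (a + n) + rudin_shapiro (a + n + 1)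
      - rs_prefix a - rudin_shapiro a \<le> rs_max_sum (n + 1)" for a
    using window_le_rs_max_sum [of a n] window_le_rs_max_sum [of "a + 1" n]
      window_le_rs_max_sum [of a "n + 1"] window_le_rs_max_sum [of "a + 1" "n + 1"]
      rs_prefix_add_1 [of a] rs_prefix_add_1 [of "a + n"] rs_prefix_add_1 [of "a + n + 1"]
    by (simp_all add: ac_simps)
  have shift:
    "4 * a + 4 * n = 4 * (a + n)" "4 * a + c + 4 * n = 4 * (a + n) + c"
    "4 * a + (4 * n + k) = 4 * (a + n) + k"
    "4 * a + 1 + (4 * n + 1) = 4 * (a + n) + 2"
    "4 * a + 1 + (4 * n + 2) = 4 * (a + n) + 3"
    "4 * a + 1 + (4 * n + 3) = 4 * (a + n + 1)"
    "4 * a + 2 + (4 * n + 1) = 4 * (a + n) + 3"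
    "4 * a + 2 + (4 * n + 2) = 4 * (a + n + 1)"
    "4 * a + 2 + (4 * n + 3) = 4 * (a + n + 1) + 1"
    "4 * a + 3 + (4 * n + 1) = 4 * (a + n + 1)"
    "4 * a + 3 + (4 * n + 2) = 4 * (a + n + 1) + 1"
    "4 * a + 3 + (4 * n + 3) = 4 * (a + n + 1) + 2" for a c k
    by simp_all
  show "rs_max_sum (4 * n) \<le> 2 * rs_max_sum n + 2"
  proof (rule rs_max_sum_le)
    fix i
    obtain a :: nat where a: "i = 4 * a \<or> i = 4 * a + 1 \<or> i = 4 * a + 2 \<or> i = 4 * a + 3"
      by (rule base4_digit_cases)
    note facts = coarse [of a] rs_bounds [of a] rs_bounds [of "a + n"] rs_bounds [of "a + n + 1"]
      rs_prefix_add_1 [of "a + n"]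
    show "rs_prefix (i + 4 * n) - rs_prefix i \<le> 2 * rs_max_sum n + 2"
      using a by (elim disjE; hypsubst; simp only: shift rs_prefix_base4;
          use facts in linarith)
  qed
  show "rs_max_sum (4 * n + 1) \<le> 2 * rs_max_sum n + 1"
  proof (rule rs_max_sum_le)
    fix i
    obtain a :: nat where a: "i = 4 * a \<or> i = 4 * a + 1 \<or> i = 4 * a + 2 \<or> i = 4 * a + 3"
      by (rule base4_digit_cases)
    note facts = coarse [of a] rs_bounds [of a] rs_bounds [of "a + n"] rs_bounds [of "a + n + 1"]
      rs_prefix_add_1 [of "a + n"]
    show "rs_prefix (i + (4 * n + 1)) - rs_prefix i \<le> 2 * rs_max_sum n + 1"
      using a by (elim disjE; hypsubst; simp only: shift rs_prefix_base4;
          use facts in linarith)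
  qed
  show "rs_max_sum (4 * n + 2) \<le> rs_max_sum n + rs_max_sum (n + 1) + 1"
  proof (rule rs_max_sum_le)
    fix i
    obtain a :: nat where a: "i = 4 * a \<or> i = 4 * a + 1 \<or> i = 4 * a + 2 \<or> i = 4 * a + 3"
      by (rule base4_digit_cases)
    note facts = coarse [of a] rs_bounds [of a] rs_bounds [of "a + n"] rs_bounds [of "a + n + 1"]
      rs_prefix_add_1 [of "a + n"]
    show "rs_prefix (i + (4 * n + 2)) - rs_prefix i \<le> rs_max_sum n + rs_max_sum (n + 1) + 1"
      using a by (elim disjE; hypsubst; simp only: shift rs_prefix_base4;
          use facts in linarith)
  qed
  show "rs_max_sum (4 * n + 3) \<le> 2 * rs_max_sum (n + 1) + 1"
  proof (rule rs_max_sum_le)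
    fix i
    obtain a :: nat where a: "i = 4 * a \<or> i = 4 * a + 1 \<or> i = 4 * a + 2 \<or> i = 4 * a + 3"
      by (rule base4_digit_cases)
    note facts = coarse [of a] rs_bounds [of a] rs_bounds [of "a + n"] rs_bounds [of "a + n + 1"]
      rs_prefix_add_1 [of "a + n"]
    show "rs_prefix (i + (4 * n + 3)) - rs_prefix i \<le> 2 * rs_max_sum (n + 1) + 1"
      using a by (elim disjE; hypsubst; simp only: shift rs_prefix_base4;
          use facts in linarith)
  qed
qed

section \<open>Maximal windows that attain the bounds\<close>

definition framed :: "nat \<Rightarrow> bool" where
  "framed n \<longleftrightarrow> (\<exists>a. rs_odd a = - 1 \<and> rs_odd (a + n) = 1 \<and>
     rs_prefix (a + n + 1) - rs_prefix (a + 1) = rs_max_sum n)"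

definition grows_right :: "nat \<Rightarrow> bool" where
  "grows_right n \<longleftrightarrow> rs_max_sum (n + 1) = rs_max_sum n + 1 \<and>
     (\<exists>a. rs_odd a = - 1 \<and> rudin_shapiro (a + n + 1) = 1 \<and>
       rs_prefix (a + n + 1) - rs_prefix (a + 1) = rs_max_sum n)"

definition drops_left :: "nat \<Rightarrow> bool" where
  "drops_left n \<longleftrightarrow> rs_max_sum (n + 1) = rs_max_sum n - 1 \<and>
     (\<exists>a. rudin_shapiro a = - 1 \<and> rs_odd (a + n) = 1 \<and>
       rs_prefix (a + n + 1) - rs_prefix (a + 1) = rs_max_sum n)"

lemma rs_max_sum_ge:
  assumes "j = i + n" "v \<le> rs_prefix j - rs_prefix i"
  shows "v \<le> rs_max_sum n"
  using window_le_rs_max_sum [of i n] assms by simp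

text \<open>
  The upper bounds are attained on windows for which every boundary correction has the
  favourable sign. For \<open>4 * n\<close> this rules out even starts, where the sum is just twice a sum over \<open>n\<close>
  terms, and starts congruent to 1 modulo 4: there the correction is
  \<open>rudin_shapiro (a + n) - rudin_shapiro a\<close>, and if this were 2, then shifting the window of length
  \<open>n\<close> to the right by one would increase its sum, so that it was not maximal.
  What remains is a start congruent to 3, whose correction \<open>rs_odd (a + n) - rs_odd a\<close> is 2 exactly
  for a framed window.
\<close>

lemma rs_max_sum_4n:
  assumes "framed n"
  shows "rs_max_sum (4 * n) = 2 * rs_max_sum n + 2"
proof (rule antisym [OF rs_max_sum_upper(1)])
  obtain a where a: "rs_odd a = - 1" "rs_odd (a + n) = 1"
    "rs_prefix (a + n + 1) - rs_prefix (a + 1) = rs_max_sum n"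
    using assms unfolding framed_def by blast
  show "2 * rs_max_sum n + 2 \<le> rs_max_sum (4 * n)"
    by (rule rs_max_sum_ge [where i = "4 * a + 3" and j = "4 * (a + n) + 3"])
      (use a in \<open>simp_all only: rs_prefix_base4 rs_prefix_add_1\<close>, simp_all)
qed

text \<open>
  The nested pair contributes windows of both lengths \<open>n\<close> and \<open>n + 1\<close>, as the middle bound needs.
  Each of the two signs at its ends settles one of the other bounds. All of this also works for
  \<open>n = 0\<close>, where no framed window exists.
\<close>

lemma rs_max_sum_4n_plus:
  assumes "grows_right n \<or> drops_left n"
  shows "rs_max_sum (4 * n + 1) = 2 * rs_max_sum n + 1"
    and "rs_max_sum (4 * n + 2) = rs_max_sum n + rs_max_sum (n + 1) + 1"
    and "rs_max_sum (4 * n + 3) = 2 * rs_max_sum (n + 1) + 1"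
proof -
  have "2 * rs_max_sum n + 1 \<le> rs_max_sum (4 * n + 1) \<and>
    rs_max_sum n + rs_max_sum (n + 1) + 1 \<le> rs_max_sum (4 * n + 2) \<and>
    2 * rs_max_sum (n + 1) + 1 \<le> rs_max_sum (4 * n + 3)"
    using assms
  proof
    assume "grows_right n"
    then obtain a where a: "rs_odd a = - 1" "rudin_shapiro (a + n + 1) = 1"
      "rs_prefix (a + n + 1) - rs_prefix (a + 1) = rs_max_sum n"
      "rs_max_sum (n + 1) = rs_max_sum n + 1"
      unfolding grows_right_def by blast
    note prefix = rs_prefix_base4 [of a] rs_prefix_base4 [of "a + 1"]
      rs_prefix_base4 [of "a + n + 1"] rs_prefix_add_1 [of a]
    show ?thesis
    proof (intro conjI)
      show "2 * rs_max_sum n + 1 \<le> rs_max_sum (4 * n + 1)"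
        by (rule rs_max_sum_ge [where i = "4 * (a + 1)" and j = "4 * (a + n + 1) + 1"])
          (simp, use a prefix in linarith)
      show "rs_max_sum n + rs_max_sum (n + 1) + 1 \<le> rs_max_sum (4 * n + 2)"
        by (rule rs_max_sum_ge [where i = "4 * a + 3" and j = "4 * (a + n + 1) + 1"])
          (simp, use a prefix in linarith)
      show "2 * rs_max_sum (n + 1) + 1 \<le> rs_max_sum (4 * n + 3)"
        by (rule rs_max_sum_ge [where i = "4 * a + 3" and j = "4 * (a + n + 1) + 2"])
          (simp, use a prefix in linarith)
    qed
  next
    assume "drops_left n"
    then obtain a where a: "rudin_shapiro a = - 1" "rs_odd (a + n) = 1"
      "rs_prefix (a + n + 1) - rs_prefix (a + 1) = rs_max_sum n"
      "rs_max_sum (n + 1) = rs_max_sum n - 1"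
      unfolding drops_left_def by blast
    note prefix = rs_prefix_base4 [of a] rs_prefix_base4 [of "a + n"]
      rs_prefix_base4 [of "a + n + 1"] rs_prefix_add_1 [of a] rs_prefix_add_1 [of "a + n"]
    show ?thesis
    proof (intro conjI)
      show "2 * rs_max_sum n + 1 \<le> rs_max_sum (4 * n + 1)"
        by (rule rs_max_sum_ge [where i = "4 * a + 2" and j = "4 * (a + n) + 3"])
          (simp, use a prefix in linarith)
      show "rs_max_sum n + rs_max_sum (n + 1) + 1 \<le> rs_max_sum (4 * n + 2)"
        by (rule rs_max_sum_ge [where i = "4 * a + 1" and j = "4 * (a + n) + 3"])
          (simp, use a prefix in linarith)
      show "2 * rs_max_sum (n + 1) + 1 \<le> rs_max_sum (4 * n + 3)"
        by (rule rs_max_sum_ge [where i = "4 * a + 1" and j = "4 * (a + n + 1)"])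
          (simp, use a prefix in linarith)
    qed
  qed
  with rs_max_sum_upper(2-4) [of n]
  show "rs_max_sum (4 * n + 1) = 2 * rs_max_sum n + 1"
    "rs_max_sum (4 * n + 2) = rs_max_sum n + rs_max_sum (n + 1) + 1"
    "rs_max_sum (4 * n + 3) = 2 * rs_max_sum (n + 1) + 1"
    by auto
qed

text \<open>
  The next three lemmas state the sign conditions for an arbitrary window \<open>{i..<j}\<close>
  whose preceding index is \<open>p\<close> and whose last index is \<open>q\<close>, so that the base 4 form of each
  of these indices can be chosen separately.
\<close>

lemma framedI:
  assumes "q = p + n" "i = p + 1" "j = q + 1" "rs_odd p = - 1" "rs_odd q = 1"
    "rs_prefix j - rs_prefix i = rs_max_sum n"
  shows "framed n"
  using assms unfolding framed_def by blast

lemma grows_rightI: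
  assumes "j = i + n" "i = p + 1" "rs_odd p = - 1" "rudin_shapiro j = 1"
    "rs_prefix j - rs_prefix i = rs_max_sum n" "rs_max_sum (n + 1) = rs_max_sum n + 1"
  shows "grows_right n"
  using assms unfolding grows_right_def by (auto intro!: exI [of _ p] simp: ac_simps)

lemma drops_leftI:
  assumes "q = p + n" "i = p + 1" "j = q + 1" "rudin_shapiro p = - 1" "rs_odd q = 1"
    "rs_prefix j - rs_prefix i = rs_max_sum n" "rs_max_sum (n + 1) = rs_max_sum n - 1"
  shows "drops_left n"
  using assms unfolding drops_left_def by blast

text \<open>
  Let \<open>b = a + n\<close>. The framed window \<open>{a + 1..b}\<close> is blown up to \<open>{4 * a + 4..<4 * b + 4}\<close> and
  shifted left by one. The shift loses the last term \<open>- rs_odd b = - 1\<close> and gains the term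
  \<open>- rs_odd a = 1\<close> in front. The term before that is \<open>rs_odd a = - 1\<close>; adding it
  lowers the sum to the maximum for length \<open>4 * n + 1\<close>, which gives the nested pair.
\<close>

lemma witnesses_4n:
  assumes "framed n" "grows_right n \<or> drops_left n"
  shows "framed (4 * n)" "drops_left (4 * n)"
proof -
  obtain a where a: "rs_odd a = - 1" "rs_odd (a + n) = 1"
    "rs_prefix (a + n + 1) - rs_prefix (a + 1) = rs_max_sum n"
    using assms unfolding framed_def by blast
  note prefix = rs_prefix_base4 [of a] rs_prefix_base4 [of "a + n"]
    rs_prefix_add_1 [of a] rs_prefix_add_1 [of "a + n"]
  note base4 = rs_odd_base4 rudin_shapiro_base4
  note vals = rs_max_sum_4n [OF assms(1)] rs_max_sum_4n_plus [OF assms(2)]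
  show "framed (4 * n)"
    by (rule framedI [where p = "4 * a + 2" and q = "4 * (a + n) + 2"
          and i = "4 * a + 3" and j = "4 * (a + n) + 3"])
      (simp, simp, simp, simp only: base4 a, simp only: base4 a, use a prefix vals in linarith)
  show "drops_left (4 * n)"
    by (rule drops_leftI [where p = "4 * a + 2" and q = "4 * (a + n) + 2"
          and i = "4 * a + 3" and j = "4 * (a + n) + 3"])
      (simp, simp, simp, simp only: base4 a, simp only: base4 a,
        (use a prefix vals in linarith)+)
qed

text \<open>The window that witnesses length \<open>4 * n\<close> can also be extended by one term \<open>- 1\<close> on the right.\<close>

lemma framed_4n_plus_1:
  assumes "framed n" "grows_right n \<or> drops_left n"
  shows "framed (4 * n + 1)"
proof -
  obtain a where a: "rs_odd a = - 1" "rs_odd (a + n) = 1"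
    "rs_prefix (a + n + 1) - rs_prefix (a + 1) = rs_max_sum n"
    using assms unfolding framed_def by blast
  note prefix = rs_prefix_base4 [of a] rs_prefix_base4 [of "a + n + 1"] rs_prefix_add_1 [of a]
  show ?thesis
    by (rule framedI [where p = "4 * a + 2" and q = "4 * (a + n) + 3"
          and i = "4 * a + 3" and j = "4 * (a + n + 1)"])
      (simp, simp, simp, simp only: rs_odd_base4 a, simp only: rs_odd_base4 a,
        use a prefix rs_max_sum_4n_plus [OF assms(2)] in linarith)
qed

text \<open>
  With \<open>b = a + n + 1\<close>, the sequence takes the value \<open>1\<close> at \<open>4 * b\<close> and \<open>4 * b + 1\<close>. So, among the
  windows that start at \<open>4 * a + 3\<close>, the sum increases by 1 from length \<open>4 * n + 1\<close> to
  \<open>4 * n + 2\<close> and again to \<open>4 * n + 3\<close>, and these three windows are all maximal.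
\<close>

lemma witnesses_grows_right:
  assumes "grows_right n"
  shows "framed (4 * n + 2)" "grows_right (4 * n + 1)" "grows_right (4 * n + 2)"
proof -
  obtain a where a: "rs_odd a = - 1" "rudin_shapiro (a + n + 1) = 1"
    "rs_prefix (a + n + 1) - rs_prefix (a + 1) = rs_max_sum n"
    "rs_max_sum (n + 1) = rs_max_sum n + 1"
    using assms unfolding grows_right_def by blast
  note prefix = rs_prefix_base4 [of a] rs_prefix_base4 [of "a + n + 1"] rs_prefix_add_1 [of a]
  note base4 = rs_odd_base4 rudin_shapiro_base4
  note vals = rs_max_sum_4n_plus [OF disjI1, OF assms]
  have incr: "4 * n + 1 + 1 = 4 * n + 2" "4 * n + 2 + 1 = 4 * n + 3" by simp_all
  show "framed (4 * n + 2)"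
    by (rule framedI [where p = "4 * a + 2" and q = "4 * (a + n + 1)"
          and i = "4 * a + 3" and j = "4 * (a + n + 1) + 1"])
      (simp, simp, simp, simp only: base4 a, simp only: base4 a, use a prefix vals in linarith)
  show "grows_right (4 * n + 1)"
    by (rule grows_rightI [where p = "4 * a + 2" and i = "4 * a + 3" and j = "4 * (a + n + 1)"])
      (simp, simp, simp only: base4 a, simp only: base4 a, unfold incr,
        (use a prefix vals in linarith)+)
  show "grows_right (4 * n + 2)"
    by (rule grows_rightI [where p = "4 * a + 2" and i = "4 * a + 3" and j = "4 * (a + n + 1) + 1"])
      (simp, simp, simp only: base4 a, simp only: base4 a, unfold incr,
        (use a prefix vals in linarith)+)
qed

text \<open>
  The sequence takes the value \<open>- 1\<close> at \<open>4 * a\<close> and \<open>4 * a + 1\<close>. So, among the windows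
  that end at \<open>4 * (a + n) + 2\<close>, the sum decreases by 1 each time that the start moves left from
  \<open>4 * a + 2\<close> to \<open>4 * a + 1\<close> and to \<open>4 * a\<close>, and these three windows are all maximal.
\<close>

lemma witnesses_drops_left:
  assumes "drops_left n"
  shows "framed (4 * n + 2)" "drops_left (4 * n + 1)" "drops_left (4 * n + 2)"
proof -
  obtain a where a: "rudin_shapiro a = - 1" "rs_odd (a + n) = 1"
    "rs_prefix (a + n + 1) - rs_prefix (a + 1) = rs_max_sum n"
    "rs_max_sum (n + 1) = rs_max_sum n - 1"
    using assms unfolding drops_left_def by blast
  note prefix = rs_prefix_base4 [of a] rs_prefix_base4 [of "a + n"]
    rs_prefix_add_1 [of a] rs_prefix_add_1 [of "a + n"]
  note base4 = rs_odd_base4 rudin_shapiro_base4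
  note vals = rs_max_sum_4n_plus [OF disjI2, OF assms]
  have incr: "4 * n + 1 + 1 = 4 * n + 2" "4 * n + 2 + 1 = 4 * n + 3" by simp_all
  show "framed (4 * n + 2)"
    by (rule framedI [where p = "4 * a" and q = "4 * (a + n) + 2"
          and i = "4 * a + 1" and j = "4 * (a + n) + 3"])
      (simp, simp, simp, simp only: base4 a, simp only: base4 a, use a prefix vals in linarith)
  show "drops_left (4 * n + 1)"
    by (rule drops_leftI [where p = "4 * a + 1" and q = "4 * (a + n) + 2"
          and i = "4 * a + 2" and j = "4 * (a + n) + 3"])
      (simp, simp, simp, simp only: base4 a, simp only: base4 a, unfold incr,
        (use a prefix vals in linarith)+)
  show "drops_left (4 * n + 2)"
    by (rule drops_leftI [where p = "4 * a" and q = "4 * (a + n) + 2"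
          and i = "4 * a + 1" and j = "4 * (a + n) + 3"])
      (simp, simp, simp, simp only: base4 a, simp only: base4 a, unfold incr,
        (use a prefix vals in linarith)+)
qed

text \<open>
  The maximal window of length \<open>4 * (n + 1)\<close> obtained from a framed window starts and ends with the
  term \<open>1\<close>. Removing its first term leaves a framed window; removing its last term instead leaves
  one that grows on the right.
\<close>

lemma witnesses_4n_plus_3:
  assumes "framed (n + 1)" "grows_right n \<or> drops_left n"
  shows "framed (4 * n + 3)" "grows_right (4 * n + 3)"
proof -
  obtain a where a: "rs_odd a = - 1" "rs_odd (a + (n + 1)) = 1"
    "rs_prefix (a + (n + 1) + 1) - rs_prefix (a + 1) = rs_max_sum (n + 1)"
    using assms unfolding framed_def by blast
  note prefix = rs_prefix_base4 [of a] rs_prefix_base4 [of "a + 1"]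
    rs_prefix_base4 [of "a + (n + 1)"] rs_prefix_add_1 [of a] rs_prefix_add_1 [of "a + (n + 1)"]
  note base4 = rs_odd_base4 rudin_shapiro_base4
  note vals = rs_max_sum_4n [OF assms(1)] rs_max_sum_4n_plus [OF assms(2)]
  have incr: "4 * n + 3 + 1 = 4 * (n + 1)" by simp
  show "framed (4 * n + 3)"
    by (rule framedI [where p = "4 * a + 3" and q = "4 * (a + (n + 1)) + 2"
          and i = "4 * (a + 1)" and j = "4 * (a + (n + 1)) + 3"])
      (simp, simp, simp, simp only: base4 a, simp only: base4 a, use a prefix vals in linarith)
  show "grows_right (4 * n + 3)"
    by (rule grows_rightI [where p = "4 * a + 2" and i = "4 * a + 3"
          and j = "4 * (a + (n + 1)) + 2"])
      (simp, simp, simp only: base4 a, simp only: base4 a, unfold incr,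
        (use a prefix vals in linarith)+)
qed

lemma rs_max_sum_0: "rs_max_sum 0 = 0"
  by (simp add: rs_max_sum_def)

lemma rudin_shapiro_initial:
  "rudin_shapiro 1 = 1" "rudin_shapiro 2 = 1" "rs_odd 1 = - 1" "rs_odd 2 = 1"
  using rudin_shapiro_odd [of 0] rudin_shapiro_even [of 1] rs_odd_odd_index [of 0]
    rs_odd_even_index [of 1]
  by (simp_all add: rudin_shapiro_0 rs_odd_def)

lemma rs_max_sum_1: "rs_max_sum 1 = 1"
proof (rule antisym)
  show "rs_max_sum 1 \<le> 1"
    using rs_prefix_add_1 rs_bounds by (intro rs_max_sum_le) (simp add: algebra_simps)
  show "1 \<le> rs_max_sum 1"
    by (rule rs_max_sum_ge [of 3 2]) (use rs_prefix_add_1 [of 2] rudin_shapiro_initial in simp_all)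
qed

text \<open>
  The window that consists of the index 2 alone starts the induction, together with the empty
  window in front of it.
\<close>

lemma grows_right_0: "grows_right 0"
  by (rule grows_rightI [where p = 1 and i = 2 and j = 2])
    (simp_all add: rudin_shapiro_initial rs_max_sum_0 rs_max_sum_1 flip: One_nat_def)

lemma framed_1: "framed 1"
  by (rule framedI [where p = 1 and q = 2 and i = 2 and j = 3])
    (use rs_prefix_add_1 [of 2] rudin_shapiro_initial in \<open>simp_all add: rs_max_sum_1 del: One_nat_def\<close>)

lemma framed_and_nested_maximal_windows:
  "(n > 0 \<longrightarrow> framed n) \<and> (grows_right n \<or> drops_left n)"
proof (induction n rule: less_induct)
  case (less n)
  obtain m where m: "n = 4 * m \<or> n = 4 * m + 1 \<or> n = 4 * m + 2 \<or> n = 4 * m + 3"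
    by (rule base4_digit_cases)
  show ?case
  proof (cases "n = 0")
    case True
    then show ?thesis using grows_right_0 by simp
  next
    case False
    with m have "m < n" by auto
    then have nested: "grows_right m \<or> drops_left m" and framed: "m > 0 \<longrightarrow> framed m"
      using less.IH by blast+
    from m show ?thesis
    proof (elim disjE)
      assume "n = 4 * m"
      then show ?thesis using witnesses_4n [of m] nested framed False by simp
    next
      assume n: "n = 4 * m + 1"
      have "framed n"
        using framed_1 framed_4n_plus_1 [OF _ nested] framed by (cases "m = 0") (simp_all add: n)
      then show ?thesis
        using witnesses_grows_right [of m] witnesses_drops_left [of m] nested n by blast
    next
      assume "n = 4 * m + 2"
      then show ?thesis
        using witnesses_grows_right [of m] witnesses_drops_left [of m] nested by blast
    next
      assume n: "n = 4 * m + 3"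
      then have "framed (m + 1)" using less.IH [of "m + 1"] by simp
      then show ?thesis using witnesses_4n_plus_3 [OF _ nested] n by blast
    qed
  qed
qed

section \<open>The recursion and automaticity\<close>

lemma rs_max_sum_base4:
  "n > 0 \<Longrightarrow> rs_max_sum (4 * n) = 2 * rs_max_sum n + 2"
  "rs_max_sum (4 * n + 1) = 2 * rs_max_sum n + 1"
  "rs_max_sum (4 * n + 2) = rs_max_sum n + rs_max_sum (n + 1) + 1"
  "rs_max_sum (4 * n + 3) = 2 * rs_max_sum (n + 1) + 1"
  using framed_and_nested_maximal_windows [of n] rs_max_sum_4n rs_max_sum_4n_plus by blast+

lemma delta_rs_max_sum_base4:
  "delta_rs_max_sum (4 * n) = (if n = 0 then 1 else - 1)"
  "delta_rs_max_sum (4 * n + 1) = delta_rs_max_sum n"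
  "delta_rs_max_sum (4 * n + 2) = delta_rs_max_sum n"
  "delta_rs_max_sum (4 * n + 3) = 1"
proof -
  have incr: "4 * n + 1 + 1 = 4 * n + 2" "4 * n + 2 + 1 = 4 * n + 3" "4 * n + 3 + 1 = 4 * (n + 1)"
    by simp_all
  note vals = rs_max_sum_base4 [of n] rs_max_sum_base4(1) [of "n + 1"]
  show "delta_rs_max_sum (4 * n) = (if n = 0 then 1 else - 1)"
    using vals rs_max_sum_0 rs_max_sum_1 by (simp add: delta_rs_max_sum_def)
  show "delta_rs_max_sum (4 * n + 1) = delta_rs_max_sum n"
    "delta_rs_max_sum (4 * n + 2) = delta_rs_max_sum n"
    "delta_rs_max_sum (4 * n + 3) = 1"
    unfolding delta_rs_max_sum_def incr using vals by linarith+
qed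

text \<open>
  Stability under the two decimations \<open>n \<mapsto> 2 * n\<close> and \<open>n \<mapsto> 2 * n + 1\<close> suffices, because every
  \<open>n \<mapsto> 2 ^ e * n + c\<close> with \<open>c < 2 ^ e\<close> is a composition of \<open>e\<close> of them.
\<close>

lemma two_automaticI:
  assumes fin: "finite K" and w: "w \<in> K"
    and even: "\<And>f. f \<in> K \<Longrightarrow> (\<lambda>n. f (2 * n)) \<in> K"
    and odd: "\<And>f. f \<in> K \<Longrightarrow> (\<lambda>n. f (2 * n + 1)) \<in> K"
  shows "two_automatic w"
proof -
  have "(\<lambda>n. w (2 ^ e * n + c)) \<in> K" if "c < 2 ^ e" for e c
    using that
  proof (induction e arbitrary: c)
    case 0
    then show ?case using w by simp
  next
    case (Suc e)
    \<comment> \<open>The top binary digit of \<open>c\<close> decides which decimation is applied last.\<close>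
    show ?case
    proof (cases "c < 2 ^ e")
      case True
      from even [OF Suc.IH [OF this]] show ?thesis by (simp add: ac_simps)
    next
      case False
      define d where "d = c - 2 ^ e"
      have "d < 2 ^ e" and c: "c = 2 ^ e + d" using Suc.prems False by (simp_all add: d_def)
      from odd [OF Suc.IH [OF this(1)]] show ?thesis by (simp add: c algebra_simps)
    qed
  qed
  then have "two_kernel w \<subseteq> K" by (auto simp: two_kernel_def)
  with fin show ?thesis unfolding two_automatic_def by (blast intro: finite_subset)
qed

lemma two_automatic_delta_rs_max_sum: "two_automatic delta_rs_max_sum"
proof -
  define h0 where "h0 = (\<lambda>n. delta_rs_max_sum (2 * n))"
  define h1 where "h1 = (\<lambda>n. delta_rs_max_sum (2 * n + 1))"
  define g where "g = (\<lambda>n::nat. if n = 0 then 1 else - 1 :: int)"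
  have index: "2 * (2 * n) = 4 * n" "2 * (2 * n + 1) = 4 * n + 2" "2 * (2 * n + 1) + 1 = 4 * n + 3"
    for n :: nat
    by simp_all
  have h: "(\<lambda>n. h0 (2 * n)) = g" "(\<lambda>n. h0 (2 * n + 1)) = delta_rs_max_sum"
    "(\<lambda>n. h1 (2 * n)) = delta_rs_max_sum" "(\<lambda>n. h1 (2 * n + 1)) = (\<lambda>n. 1)"
    using delta_rs_max_sum_base4 index unfolding h0_def h1_def g_def by (simp_all only: fun_eq_iff simp_thms)
  have g: "(\<lambda>n. g (2 * n)) = g" "(\<lambda>n. g (2 * n + 1)) = (\<lambda>n. - 1)"
    by (auto simp: g_def)
  show ?thesis
  proof (rule two_automaticI)
    let ?K = "{delta_rs_max_sum, h0, h1, g, \<lambda>n. 1, \<lambda>n. - 1}"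
    show "finite ?K" "delta_rs_max_sum \<in> ?K" by simp_all
    show "(\<lambda>n. f (2 * n)) \<in> ?K" if "f \<in> ?K" for f
      using that h g unfolding insert_iff by (elim disjE) (simp_all add: h0_def)
    show "(\<lambda>n. f (2 * n + 1)) \<in> ?K" if "f \<in> ?K" for f
      using that h g unfolding insert_iff by (elim disjE) (simp_all add: h1_def)
  qed
qed

theorem corollary2:
  shows "(\<forall>i::nat. i \<le> 3 \<longrightarrow> delta_rs_max_sum i = 1) \<and>
    (\<forall>n::nat. n \<ge> 1 \<longrightarrow>
        delta_rs_max_sum (4 * n) = - delta_rs_max_sum (4 * n + 3) \<and>
        - delta_rs_max_sum (4 * n + 3) = -1 \<and>
        delta_rs_max_sum (4 * n + 1) = delta_rs_max_sum (4 * n + 2) \<and>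
        delta_rs_max_sum (4 * n + 2) = delta_rs_max_sum n) \<and>
    two_automatic delta_rs_max_sum"
proof (intro conjI allI impI)
  fix i :: nat
  assume "i \<le> 3"
  then have "i = 0 \<or> i = 1 \<or> i = 2 \<or> i = 3" by auto
  then show "delta_rs_max_sum i = 1"
    using delta_rs_max_sum_base4 [of 0] by (elim disjE) (simp_all add: numeral_2_eq_2)
qed (simp_all only: delta_rs_max_sum_base4 two_automatic_delta_rs_max_sum, simp_all)

end
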